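(* Let $U$ be a c.e. theory and let $\mathcal F$ be any function from sets of sentences of the language of $U$ to sets of sentences of that language. Suppose $U$ is effectively if-essentially $\mathcal F$-incomplete. Then $U$ is effectively $\mathcal F(U)$-inseparable.
   Context: Theories are sets of axioms (sentences) in a fixed first-order signature; sentences are identified with their Gödel numbers and $\mathsf W_0,\mathsf W_1,\dots$ is a standard enumeration of the c.e. sets. For a theory $T$, $T_{\mathfrak p}$ is the set of sentences provable in $T$ and $T_{\mathfrak r}=\{\phi \mid T\vdash\neg\phi\}$. The function $\mathcal F$ is not required to be effective and may take the empty set as value. $U$ is effectively if-essentially $\mathcal F$-incomplete iff there is a partial computable function $\Phi$ such that for every $i$: if $\mathsf W_i$ is a consistent finite extension of $U$ (i.e. $U\subseteq \mathsf W_i$, $\mathsf W_i\setminus U$ is finite, same language), then $\Phi(i)$ converges, $\Phi(i)\in\mathcal F(\mathsf W_i)$, and $\Phi(i)$ is independent of $\mathsf W_i$. Sets $\mathcal Z,\mathcal W$ weakly biseparate $\mathcal X,\mathcal Y$ iff $\mathcal X\subseteq\mathcal Z$, $\mathcal Y\subseteq\mathcal W$, $\mathcal Z\cap\mathcal Y=\emptyset$, $\mathcal W\cap\mathcal X=\emptyset$. For a set of sentences $\mathcal X$, $U$ is effectively $\mathcal X$-inseparable iff there is a partial computable function $\Psi$ such that for all $i,j$, if $\mathsf W_i,\mathsf W_j$ weakly biseparate $U_{\mathfrak p}$ and $U_{\mathfrak r}$, then $\Psi(i,j)$ converges, $\Psi(i,j)\in\mathcal X$ and $\Psi(i,j)\notin\mathsf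 W_i\cup\mathsf W_j$. *)

theory Defs
  imports Main "HOL-Library.Nat_Bijection" "HOL-Library.FuncSet"
begin

section \<open>Computability\<close>

text \<open>
  The partial computable functions, presented as unary functions on the natural numbers;
  further arguments are passed through the bijective pairing function \<^const>\<open>prod_encode\<close>.
  The identity is \<open>PPair PLeft PRight\<close>.
\<close>

datatype prog =
    PZero
  | PSucc
  | PLeft
  | PRight
  | PPair prog prog
  | PComp prog prog
  | PRec prog prog
  | PMu prog

text \<open>
  \<open>PRec f g\<close> is primitive recursion: \<open>h (a, 0) = f a\<close> and
  \<open>h (a, n + 1) = g (a, (n, h (a, n)))\<close>.  \<open>PMu f\<close> is unbounded minimization: it sends \<open>x\<close> to
  the least \<open>n\<close> with \<open>f (x, n) = 0\<close>, provided \<open>f (x, m)\<close> is defined for all \<open>m < n\<close>.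
\<close>

primrec run :: "prog \<Rightarrow> nat \<Rightarrow> nat option" where
  "run PZero = (\<lambda>x. Some 0)"
| "run PSucc = (\<lambda>x. Some (Suc x))"
| "run PLeft = (\<lambda>x. Some (fst (prod_decode x)))"
| "run PRight = (\<lambda>x. Some (snd (prod_decode x)))"
| "run (PPair f g) = (\<lambda>x. Option.bind (run f x) (\<lambda>a.
     Option.bind (run g x) (\<lambda>b. Some (prod_encode (a, b)))))"
| "run (PComp f g) = (\<lambda>x. Option.bind (run g x) (run f))"
| "run (PRec f g) = (\<lambda>x. case prod_decode x of (a, n) \<Rightarrow>
     rec_nat (run f a)
       (\<lambda>m r. Option.bind r (\<lambda>v. run g (prod_encode (a, prod_encode (m, v))))) n)"
| "run (PMu f) = (\<lambda>x.
     if \<exists>n. run f (prod_encode (x, n)) = Some 0 \<and>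
            (\<forall>m<n. run f (prod_encode (x, m)) \<noteq> None)
     then Some (LEAST n. run f (prod_encode (x, n)) = Some 0)
     else None)"

definition partial_computable :: "(nat \<Rightarrow> nat option) \<Rightarrow> bool" where
  "partial_computable f \<longleftrightarrow> (\<exists>p. run p = f)"

definition partial_computable2 :: "(nat \<Rightarrow> nat \<Rightarrow> nat option) \<Rightarrow> bool" where
  "partial_computable2 f \<longleftrightarrow> partial_computable (\<lambda>x. case prod_decode x of (i, j) \<Rightarrow> f i j)"

definition computable :: "(nat \<Rightarrow> nat) \<Rightarrow> bool" where
  "computable f \<longleftrightarrow> partial_computable (\<lambda>x. Some (f x))"

text \<open>Every number is the index of a program, and every program has an index.\<close>

function prog_of :: "nat \<Rightarrow> prog" where
  "prog_of n =
    (let k = fst (prod_decode n); m = snd (prod_decode n);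
         a = fst (prod_decode m); b = snd (prod_decode m) in
     if k = 0 then PZero
     else if k = 1 then PSucc
     else if k = 2 then PLeft
     else if k = 3 then PRight
     else if k = 4 then PPair (prog_of a) (prog_of b)
     else if k = 5 then PComp (prog_of a) (prog_of b)
     else if k = 6 then PRec (prog_of a) (prog_of b)
     else PMu (prog_of m))"
  by pat_completeness auto

lemma prod_decode_le: "fst (prod_decode m) \<le> m" "snd (prod_decode m) \<le> m"
  using le_prod_encode_1[of "fst (prod_decode m)" "snd (prod_decode m)"]
    le_prod_encode_2[of "snd (prod_decode m)" "fst (prod_decode m)"]
  by simp_all

lemma snd_prod_decode_less:
  assumes "fst (prod_decode n) \<noteq> 0"
  shows "snd (prod_decode n) < n"
proof -
  obtain k m where km: "prod_decode n = (k, m)" by (cases "prod_decode n")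
  then have "n = prod_encode (k, m)" by (metis prod_decode_inverse)
  moreover have "m \<le> triangle (k + m)"
    by (induction m) (simp_all add: triangle_Suc)
  ultimately show ?thesis
    using assms km by (simp add: prod_encode_def)
qed

termination prog_of
proof (relation "measure id")
  fix n k m a b :: nat
  assume "k = fst (prod_decode n)" "m = snd (prod_decode n)" "k \<noteq> 0"
  then have "m < n" using snd_prod_decode_less by simp
  then show "(m, n) \<in> measure id" by simp
  assume "a = fst (prod_decode m)"
  then show "(a, n) \<in> measure id" "(a, n) \<in> measure id" "(a, n) \<in> measure id"
    using \<open>m < n\<close> prod_decode_le(1)[of m] by simp_all
  assume "b = snd (prod_decode m)"
  then show "(b, n) \<in> measure id" "(b, n) \<in> measure id" "(b, n) \<in> measure id"
    using \<open>m < n\<close> prod_decode_le(2)[of m] by simp_all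
qed simp

declare prog_of.simps [simp del]

primrec prog_num :: "prog \<Rightarrow> nat" where
  "prog_num PZero = prod_encode (0, 0)"
| "prog_num PSucc = prod_encode (1, 0)"
| "prog_num PLeft = prod_encode (2, 0)"
| "prog_num PRight = prod_encode (3, 0)"
| "prog_num (PPair f g) = prod_encode (4, prod_encode (prog_num f, prog_num g))"
| "prog_num (PComp f g) = prod_encode (5, prod_encode (prog_num f, prog_num g))"
| "prog_num (PRec f g) = prod_encode (6, prod_encode (prog_num f, prog_num g))"
| "prog_num (PMu f) = prod_encode (7, prog_num f)"

lemma prog_of_prog_num: "prog_of (prog_num p) = p"
  by (induction p) (simp_all add: prog_of.simps[of "prod_encode x" for x] Let_def)

text \<open>The standard enumeration of the c.e. sets: the domain of the partial function with index \<open>i\<close>.\<close>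

definition W :: "nat \<Rightarrow> nat set" where
  "W i = {x. run (prog_of i) x \<noteq> None}"

definition ce :: "nat set \<Rightarrow> bool" where
  "ce A \<longleftrightarrow> (\<exists>i. A = W i)"


section \<open>First-order logic with equality\<close>

text \<open>
  Function and relation symbols are natural numbers.  A signature says which numbers are used as
  symbols, and with which arity; constants are function symbols of arity 0.
\<close>

record signature =
  fun_arity :: "nat \<Rightarrow> nat option"
  rel_arity :: "nat \<Rightarrow> nat option"

text \<open>The symbols form a decidable set and arities are computable, e.g. the signature is finite.\<close>

definition effective_signature :: "signature \<Rightarrow> bool" where
  "effective_signature L \<longleftrightarrow>
     computable (\<lambda>n. case fun_arity L n of None \<Rightarrow> 0 | Some k \<Rightarrow> Suc k) \<and>
     computable (\<lambda>n. case rel_arity L n of None \<Rightarrow> 0 | Some k \<Rightarrow> Suc k)"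

text \<open>
  Variables are de Bruijn indices.  The primitive logical symbols are equality, negation,
  implication and the universal quantifier.
\<close>

datatype tm = Var nat | Fun nat "tm list"

datatype fm = Eq tm tm | Rel nat "tm list" | Neg fm | Imp fm fm | All fm

fun wf_tm :: "signature \<Rightarrow> tm \<Rightarrow> bool" where
  "wf_tm L (Var n) \<longleftrightarrow> True"
| "wf_tm L (Fun f ts) \<longleftrightarrow> fun_arity L f = Some (length ts) \<and> (\<forall>t\<in>set ts. wf_tm L t)"

fun wf_fm :: "signature \<Rightarrow> fm \<Rightarrow> bool" where
  "wf_fm L (Eq s t) \<longleftrightarrow> wf_tm L s \<and> wf_tm L t"
| "wf_fm L (Rel r ts) \<longleftrightarrow> rel_arity L r = Some (length ts) \<and> (\<forall>t\<in>set ts. wf_tm L t)"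
| "wf_fm L (Neg p) \<longleftrightarrow> wf_fm L p"
| "wf_fm L (Imp p q) \<longleftrightarrow> wf_fm L p \<and> wf_fm L q"
| "wf_fm L (All p) \<longleftrightarrow> wf_fm L p"

fun fv_tm :: "tm \<Rightarrow> nat set" where
  "fv_tm (Var n) = {n}"
| "fv_tm (Fun f ts) = (\<Union>t\<in>set ts. fv_tm t)"

fun fv :: "fm \<Rightarrow> nat set" where
  "fv (Eq s t) = fv_tm s \<union> fv_tm t"
| "fv (Rel r ts) = (\<Union>t\<in>set ts. fv_tm t)"
| "fv (Neg p) = fv p"
| "fv (Imp p q) = fv p \<union> fv q"
| "fv (All p) = {n. Suc n \<in> fv p}"

definition sentences :: "signature \<Rightarrow> fm set" where
  "sentences L = {p. wf_fm L p \<and> fv p = {}}"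

primrec subst_tm :: "(nat \<Rightarrow> tm) \<Rightarrow> tm \<Rightarrow> tm" where
  "subst_tm s (Var n) = s n"
| "subst_tm s (Fun f ts) = Fun f (map (subst_tm s) ts)"

primrec subst :: "(nat \<Rightarrow> tm) \<Rightarrow> fm \<Rightarrow> fm" where
  "subst s (Eq t u) = Eq (subst_tm s t) (subst_tm s u)"
| "subst s (Rel r ts) = Rel r (map (subst_tm s) ts)"
| "subst s (Neg p) = Neg (subst s p)"
| "subst s (Imp p q) = Imp (subst s p) (subst s q)"
| "subst s (All p) = All (subst (case_nat (Var 0) (\<lambda>n. subst_tm (\<lambda>k. Var (Suc k)) (s n))) p)"

definition shift :: "fm \<Rightarrow> fm" where
  "shift = subst (\<lambda>n. Var (Suc n))"

definition inst :: "tm \<Rightarrow> fm \<Rightarrow> fm" where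
  "inst t = subst (case_nat t Var)"

text \<open>
  Classical natural deduction.  In the rule \<open>AllI\<close> the shift frees the index 0, which plays the
  role of the eigenvariable.
\<close>

inductive deriv :: "signature \<Rightarrow> fm set \<Rightarrow> fm \<Rightarrow> bool" for L :: signature where
  Assm: "p \<in> G \<Longrightarrow> deriv L G p"
| ImpI: "wf_fm L p \<Longrightarrow> deriv L (insert p G) q \<Longrightarrow> deriv L G (Imp p q)"
| ImpE: "deriv L G (Imp p q) \<Longrightarrow> deriv L G p \<Longrightarrow> deriv L G q"
| NegI: "wf_fm L p \<Longrightarrow> deriv L (insert p G) q \<Longrightarrow> deriv L (insert p G) (Neg q) \<Longrightarrow> deriv L G (Neg p)"
| Contr: "wf_fm L p \<Longrightarrow> deriv L (insert (Neg p) G) q \<Longrightarrow> deriv L (insert (Neg p) G) (Neg q)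
    \<Longrightarrow> deriv L G p"
| AllI: "deriv L (shift ` G) p \<Longrightarrow> deriv L G (All p)"
| AllE: "deriv L G (All p) \<Longrightarrow> wf_tm L t \<Longrightarrow> deriv L G (inst t p)"
| EqI: "wf_tm L t \<Longrightarrow> deriv L G (Eq t t)"
| EqE: "wf_fm L p \<Longrightarrow> deriv L G (Eq s t) \<Longrightarrow> deriv L G (inst s p) \<Longrightarrow> deriv L G (inst t p)"

primrec tm_num :: "tm \<Rightarrow> nat" where
  "tm_num (Var n) = prod_encode (0, n)"
| "tm_num (Fun f ts) = prod_encode (1, prod_encode (f, list_encode (map tm_num ts)))"

text \<open>\<open>gn p\<close> is the Goedel number of \<open>p\<close>.\<close>

primrec gn :: "fm \<Rightarrow> nat" where
  "gn (Eq s t) = prod_encode (0, prod_encode (tm_num s, tm_num t))"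
| "gn (Rel r ts) = prod_encode (1, prod_encode (r, list_encode (map tm_num ts)))"
| "gn (Neg p) = prod_encode (2, gn p)"
| "gn (Imp p q) = prod_encode (3, prod_encode (gn p, gn q))"
| "gn (All p) = prod_encode (4, gn p)"

lemma tm_num_inject: "tm_num s = tm_num t \<Longrightarrow> s = t"
proof (induction s arbitrary: t)
  case (Var n) then show ?case by (cases t) auto
next
  case (Fun f ts)
  then obtain us where t: "t = Fun f us" and eq: "map tm_num ts = map tm_num us"
    by (cases t) (auto simp: list_encode_eq)
  have "ts = us"
    using eq Fun.IH by (metis list.inj_map_strong)
  with t show ?case by simp
qed

lemma inj_gn: "inj gn"
proof (rule injI)
  fix p q show "gn p = gn q \<Longrightarrow> p = q"
  proof (induction p arbitrary: q)
    case (Eq s t) then show ?case by (cases q) (auto dest: tm_num_inject)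
  next
    case (Rel r ts)
    have "map tm_num ts = map tm_num us \<Longrightarrow> ts = us" for us
      by (metis list.inj_map_strong tm_num_inject)
    with Rel show ?case by (cases q) (auto simp: list_encode_eq)
  next
    case (Neg p) then show ?case by (cases q) auto
  next
    case (Imp p1 p2) then show ?case by (cases q) auto
  next
    case (All p) then show ?case by (cases q) auto
  qed
qed


section \<open>Theories\<close>

definition is_theory :: "signature \<Rightarrow> fm set \<Rightarrow> bool" where
  "is_theory L T \<longleftrightarrow> T \<subseteq> sentences L"

definition ce_theory :: "signature \<Rightarrow> fm set \<Rightarrow> bool" where
  "ce_theory L T \<longleftrightarrow> is_theory L T \<and> ce (gn ` T)"

definition provable_set :: "signature \<Rightarrow> fm set \<Rightarrow> fm set" where
  "provable_set L T = {p \<in> sentences L. deriv L T p}"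

definition refutable_set :: "signature \<Rightarrow> fm set \<Rightarrow> fm set" where
  "refutable_set L T = {p \<in> sentences L. deriv L T (Neg p)}"

definition consistent :: "signature \<Rightarrow> fm set \<Rightarrow> bool" where
  "consistent L T \<longleftrightarrow> \<not> (\<exists>p\<in>sentences L. deriv L T p \<and> deriv L T (Neg p))"

definition independent :: "signature \<Rightarrow> fm set \<Rightarrow> fm \<Rightarrow> bool" where
  "independent L T p \<longleftrightarrow> p \<in> sentences L \<and> \<not> deriv L T p \<and> \<not> deriv L T (Neg p)"

definition finite_extension :: "signature \<Rightarrow> fm set \<Rightarrow> fm set \<Rightarrow> bool" where
  "finite_extension L U T \<longleftrightarrow> is_theory L T \<and> U \<subseteq> T \<and> finite (T - U)"

text \<open>
  Since \<^const>\<open>gn\<close> is injective, the theory \<open>T\<close> below is determined by \<open>i\<close>: it is \<open>W i\<close> under the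
  identification of sentences with their Goedel numbers.
\<close>

definition effectively_if_essentially_incomplete ::
    "signature \<Rightarrow> (fm set \<Rightarrow> fm set) \<Rightarrow> fm set \<Rightarrow> bool" where
  "effectively_if_essentially_incomplete L F U \<longleftrightarrow>
     (\<exists>\<Phi>. partial_computable \<Phi> \<and>
        (\<forall>i T. W i = gn ` T \<and> finite_extension L U T \<and> consistent L T \<longrightarrow>
           (\<exists>p. \<Phi> i = Some (gn p) \<and> p \<in> F T \<and> independent L T p)))"

definition weakly_biseparate :: "nat set \<Rightarrow> nat set \<Rightarrow> nat set \<Rightarrow> nat set \<Rightarrow> bool" where
  "weakly_biseparate Z V X Y \<longleftrightarrow> X \<subseteq> Z \<and> Y \<subseteq> V \<and> Z \<inter> Y = {} \<and> V \<inter> X = {}"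

definition effectively_inseparable :: "signature \<Rightarrow> fm set \<Rightarrow> fm set \<Rightarrow> bool" where
  "effectively_inseparable L X U \<longleftrightarrow>
     (\<exists>\<Psi>. partial_computable2 \<Psi> \<and>
        (\<forall>i j. weakly_biseparate (W i) (W j) (gn ` provable_set L U) (gn ` refutable_set L U) \<longrightarrow>
           (\<exists>p. \<Psi> i j = Some (gn p) \<and> p \<in> X \<and> gn p \<notin> W i \<union> W j)))"

end

theory Submission
  imports Defs
begin

text \<open>
  Let \<open>\<Phi>\<close> witness the incompleteness of \<open>U\<close> and let \<open>W i\<close>, \<open>W j\<close> weakly biseparate the provable
  and the refutable sentences.  By the recursion theorem there is an index \<open>k\<close>, computable from
  \<open>i\<close> and \<open>j\<close>, such that \<open>W k\<close> is \<open>U\<close>, extended as soon as \<open>\<Phi> k\<close> turns out to be a sentence \<open>p\<close>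
  of \<open>W i \<union> W j\<close>: by \<open>p\<close> if \<open>p\<close> is found in \<open>W i\<close> first, and by \<open>Neg p\<close> otherwise.  In the first case
  \<open>p\<close> is not refutable, in the second it is not provable, so the extension would be a consistent
  theory deciding \<open>\<Phi> k\<close>, which is absurd.  Hence \<open>W k = U\<close>, and \<open>\<Phi> k\<close> is a member of \<open>F U\<close>
  outside \<open>W i \<union> W j\<close>.  It must be verified that \<open>\<Phi> k\<close> is a sentence, since \<open>W i\<close> and \<open>W j\<close> may
  contain numbers that are not codes of sentences; this is where the signature has to be effective.
\<close>

section \<open>Closure properties of the computable functions\<close>

abbreviation pair :: "nat \<Rightarrow> nat \<Rightarrow> nat" where
  "pair a b \<equiv> prod_encode (a, b)"

abbreviation lft :: "nat \<Rightarrow> nat" where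
  "lft x \<equiv> fst (prod_decode x)"

abbreviation rgt :: "nat \<Rightarrow> nat" where
  "rgt x \<equiv> snd (prod_decode x)"

lemma computable_iff: "computable f \<longleftrightarrow> (\<exists>p. \<forall>x. run p x = Some (f x))"
  by (auto simp: computable_def partial_computable_def fun_eq_iff)

lemma computableI: "(\<And>x. run p x = Some (f x)) \<Longrightarrow> computable f"
  by (auto simp: computable_iff)

lemma computable_id: "computable (\<lambda>x. x)"
  by (rule computableI[of "PPair PLeft PRight"]) simp

lemma computable_comp:
  assumes "computable g" "computable f"
  shows "computable (\<lambda>x. g (f x))"
proof -
  obtain p q where "\<forall>x. run p x = Some (g x)" "\<forall>x. run q x = Some (f x)"
    using assms by (auto simp: computable_iff)
  then show ?thesis by (intro computableI[of "PComp p q"]) simp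
qed

lemma computable_Suc: "computable f \<Longrightarrow> computable (\<lambda>x. Suc (f x))"
  by (rule computable_comp[of Suc]) (auto intro: computableI[of PSucc])

lemma computable_lft: "computable f \<Longrightarrow> computable (\<lambda>x. lft (f x))"
  by (rule computable_comp[of lft]) (auto intro: computableI[of PLeft])

lemma computable_rgt: "computable f \<Longrightarrow> computable (\<lambda>x. rgt (f x))"
  by (rule computable_comp[of rgt]) (auto intro: computableI[of PRight])

lemma computable_const: "computable (\<lambda>x. c)"
proof (induction c)
  case 0
  show ?case by (rule computableI[of PZero]) simp
qed (rule computable_Suc)

lemma computable_pair:
  assumes "computable f" "computable g"
  shows "computable (\<lambda>x. pair (f x) (g x))"
proof -
  obtain p q where "\<forall>x. run p x = Some (f x)" "\<forall>x. run q x = Some (g x)"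
    using assms by (auto simp: computable_iff)
  then show ?thesis by (intro computableI[of "PPair p q"]) simp
qed

text \<open>\<open>PRec\<close> takes parameter and bound packed into one argument; precomposing
  with \<open>pair (a x) (n x)\<close> lets both be computed from \<open>x\<close>.\<close>

lemma computable_rec:
  assumes f: "computable f" and g: "computable g" and "computable a" "computable n"
  shows "computable (\<lambda>x. rec_nat (f (a x)) (\<lambda>m r. g (pair (a x) (pair m r))) (n x))"
proof -
  obtain p q where pq: "\<forall>x. run p x = Some (f x)" "\<forall>x. run q x = Some (g x)"
    using f g by (auto simp: computable_iff)
  have "computable (\<lambda>x. rec_nat (f (lft x)) (\<lambda>m r. g (pair (lft x) (pair m r))) (rgt x))"
  proof (rule computableI)
    have "rec_nat (run p b) (\<lambda>m r. Option.bind r (\<lambda>v. run q (pair b (pair m v)))) k =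
        Some (rec_nat (f b) (\<lambda>m r. g (pair b (pair m r))) k)" for b k
      by (induction k) (simp_all add: pq)
    then show "run (PRec p q) x = Some (rec_nat (f (lft x)) (\<lambda>m r. g (pair (lft x) (pair m r))) (rgt x))" for x
      by (simp add: case_prod_beta)
  qed
  from computable_comp[OF this computable_pair[OF assms(3,4)]] show ?thesis by simp
qed

text \<open>Iteration is primitive recursion whose step ignores parameter and counter. It is what
  makes running a machine for \<open>n\<close> steps computable.\<close>

lemma computable_funpow:
  assumes "computable g" "computable a" "computable n"
  shows "computable (\<lambda>x. (g ^^ n x) (a x))"
proof -
  have "computable (\<lambda>y. g (rgt (rgt y)))"
    by (intro computable_comp[OF assms(1)] computable_rgt computable_id)
  from computable_rec[OF computable_id this assms(2,3)]
  have "computable (\<lambda>x. rec_nat (a x) (\<lambda>m r. g r) (n x))" by simp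
  moreover have "rec_nat y (\<lambda>m r. g r) k = (g ^^ k) y" for k y
    by (induction k) simp_all
  ultimately show ?thesis by simp
qed

lemma computable_pred:
  assumes "computable f"
  shows "computable (\<lambda>x. f x - 1)"
proof -
  have "computable (\<lambda>y. lft (rgt y))"
    by (intro computable_lft computable_rgt computable_id)
  from computable_rec[OF computable_const[of 0] this computable_id assms]
  have "computable (\<lambda>x. rec_nat 0 (\<lambda>m r. m) (f x))" by simp
  moreover have "rec_nat 0 (\<lambda>m r. m) k = k - 1" for k :: nat
    by (cases k) simp_all
  ultimately show ?thesis by simp
qed

lemma computable_add:
  assumes "computable f" "computable g"
  shows "computable (\<lambda>x. f x + g x)"
  using computable_funpow[OF computable_Suc[OF computable_id] assms] by (simp add: add.commute)

lemma computable_diff: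
  assumes "computable f" "computable g"
  shows "computable (\<lambda>x. f x - g x)"
proof -
  have "((\<lambda>y. y - 1) ^^ b) a = a - b" for a b :: nat by (induction b) simp_all
  with computable_funpow[OF computable_pred[OF computable_id] assms] show ?thesis by simp
qed

lemma computable_if:
  assumes "computable f" "computable g" "computable h" "computable k"
  shows "computable (\<lambda>x. if f x = g x then h x else k x)"
proof -
  \<comment> \<open>The sum of the two truncated differences vanishes exactly when
    \<open>f x = g x\<close>. Recursion on it with a constant step branches between base value and
    step value.\<close>
  have c: "computable (\<lambda>x. (f x - g x) + (g x - f x))"
    by (intro computable_add computable_diff assms)
  have "computable (\<lambda>y. k (lft y))"
    by (intro computable_comp[OF assms(4)] computable_lft computable_id)
  from computable_rec[OF assms(3) this computable_id c]
  have "computable (\<lambda>x. rec_nat (h x) (\<lambda>m r. k x) ((f x - g x) + (g x - f x)))" by simp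
  moreover have "rec_nat (h x) (\<lambda>m r. k x) ((f x - g x) + (g x - f x))
      = (if f x = g x then h x else k x)" for x
    by (cases "(f x - g x) + (g x - f x)") auto
  ultimately show ?thesis by simp
qed

lemmas computable_intros = computable_id computable_const computable_Suc computable_lft
  computable_rgt computable_pair computable_add computable_diff computable_if

section \<open>Partial computable functions: sequencing and search\<close>

lemma partial_computable_of_computable: "computable f \<Longrightarrow> partial_computable (\<lambda>x. Some (f x))"
  by (simp add: computable_def)

lemma partial_computable_bind:
  assumes "partial_computable g" "partial_computable f"
  shows "partial_computable (\<lambda>x. Option.bind (f x) (\<lambda>y. g (pair x y)))"
proof -
  obtain p q where "run p = g" "run q = f"
    using assms by (auto simp: partial_computable_def)
  then have "run (PComp p (PPair (PPair PLeft PRight) q))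
      = (\<lambda>x. Option.bind (f x) (\<lambda>y. g (pair x y)))"
    by (auto simp: fun_eq_iff split: Option.bind_split)
  then show ?thesis unfolding partial_computable_def by blast
qed

lemma partial_computable_comp:
  assumes "partial_computable g" "computable f"
  shows "partial_computable (\<lambda>x. g (f x))"
proof -
  obtain p q where "run p = g" "\<forall>x. run q x = Some (f x)"
    using assms by (auto simp: computable_iff partial_computable_def)
  then have "run (PComp p q) = (\<lambda>x. g (f x))" by (auto simp: fun_eq_iff)
  then show ?thesis unfolding partial_computable_def by blast
qed

text \<open>This is \<open>PMu\<close> for a total \<open>f\<close>, where the condition that all
  earlier values be defined is automatic.\<close>

definition search :: "(nat \<Rightarrow> nat) \<Rightarrow> nat \<Rightarrow> nat option" where
  "search f x = (if \<exists>n. f (pair x n) = 0 then Some (LEAST n. f (pair x n) = 0) else None)"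

lemma search_Some: "search f x = Some n \<Longrightarrow> f (pair x n) = 0"
  by (auto simp: search_def split: if_splits intro: LeastI)

lemma search_None: "search f x = None \<longleftrightarrow> (\<forall>n. f (pair x n) \<noteq> 0)"
  by (simp add: search_def)

lemma partial_computable_search:
  assumes "computable f"
  shows "partial_computable (search f)"
proof -
  obtain p where "\<forall>x. run p x = Some (f x)"
    using assms by (auto simp: computable_iff)
  then have "run (PMu p) = search f" by (auto simp: fun_eq_iff search_def)
  then show ?thesis unfolding partial_computable_def by blast
qed


section \<open>Reachability under iteration\<close>

definition iterates_to :: "('a \<Rightarrow> 'a) \<Rightarrow> 'a \<Rightarrow> 'a \<Rightarrow> bool" where
  "iterates_to f s t \<longleftrightarrow> (\<exists>n. (f ^^ n) s = t)"

lemma iterates_to_refl: "iterates_to f s s"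
  unfolding iterates_to_def by (rule exI[of _ 0]) simp

lemma iterates_to_eq: "s = t \<Longrightarrow> iterates_to f s t"
  by (simp add: iterates_to_refl)

lemma iterates_to_trans [trans]: "iterates_to f s t \<Longrightarrow> iterates_to f t u \<Longrightarrow> iterates_to f s u"
  unfolding iterates_to_def by (metis comp_apply funpow_add)

lemma iterates_to_step: "iterates_to f (f s) t \<Longrightarrow> iterates_to f s t"
  unfolding iterates_to_def by (metis comp_apply funpow_Suc_right)


section \<open>A universal machine\<close>

text \<open>
  A state either evaluates the program with index \<open>e\<close> at \<open>x\<close> or returns a value, in both cases to
  a stack of frames coded as by \<^const>\<open>list_encode\<close>.  A frame consists of a tag and two data.
\<close>

definition evl :: "nat \<Rightarrow> nat \<Rightarrow> nat \<Rightarrow> nat" where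
  "evl e x K = pair 0 (pair e (pair x K))"

definition ret :: "nat \<Rightarrow> nat \<Rightarrow> nat" where
  "ret y K = pair 1 (pair y K)"

definition push :: "nat \<Rightarrow> nat \<Rightarrow> nat \<Rightarrow> nat \<Rightarrow> nat" where
  "push t p q K = Suc (pair (pair t (pair p q)) K)"

text \<open>Tags of frames: 0 holds the pending second half of a pair, 1 the value of the first
  half, 2 the outer program of a composition, 3 the step program of a recursion with its argument, 4
  a minimization with the candidate under test.\<close>

definition eval_step :: "nat \<Rightarrow> nat \<Rightarrow> nat \<Rightarrow> nat" where
  "eval_step e x K =
    (let k = lft e; m = rgt e; a = lft m; b = rgt m in
     if k = 0 then ret 0 K
     else if k = 1 then ret (Suc x) K
     else if k = 2 then ret (lft x) K
     else if k = 3 then ret (rgt x) K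
     else if k = 4 then evl a x (push 0 b x K)
     else if k = 5 then evl b x (push 2 a 0 K)
     else if k = 6 then
       (if rgt x = 0 then evl a (lft x) K
        else evl e (pair (lft x) (rgt x - 1)) (push 3 b x K))
     else evl m (pair x 0) (push 4 m (pair x 0) K))"

text \<open>The empty stack is coded by 0; a value returned to it is a fixed point, so a finished
  run stays finished.\<close>

definition ret_step :: "nat \<Rightarrow> nat \<Rightarrow> nat" where
  "ret_step y K =
    (if K = 0 then ret y 0 else
     let F = lft (K - 1); R = rgt (K - 1); t = lft F; p = lft (rgt F); q = rgt (rgt F) in
     if t = 0 then evl p q (push 1 y 0 R)
     else if t = 1 then ret (pair p y) R
     else if t = 2 then evl p y R
     else if t = 3 then evl p (pair (lft q) (pair (rgt q - 1) y)) R
     else if y = 0 then ret (rgt q) R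
     else evl p (pair (lft q) (Suc (rgt q))) (push 4 p (pair (lft q) (Suc (rgt q))) R))"

definition step :: "nat \<Rightarrow> nat" where
  "step s = (if lft s = 0 then eval_step (lft (rgt s)) (lft (rgt (rgt s))) (rgt (rgt (rgt s)))
             else ret_step (lft (rgt s)) (rgt (rgt s)))"

lemma computable_step: "computable step"
  unfolding step_def[abs_def] eval_step_def ret_step_def evl_def ret_def push_def Let_def
  by (intro computable_intros)

lemma step_evl: "step (evl e x K) = eval_step e x K"
  by (simp add: step_def evl_def)

lemma step_ret: "step (ret y K) = ret_step y K"
  by (simp add: step_def ret_def)

section \<open>Soundness of the machine: the denotation of a state\<close>

definition mu_from :: "prog \<Rightarrow> nat \<Rightarrow> nat \<Rightarrow> nat option" where
  "mu_from f x m = (if \<exists>n\<ge>m. run f (pair x n) = Some 0 \<and>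
            (\<forall>l. m \<le> l \<and> l < n \<longrightarrow> run f (pair x l) \<noteq> None)
     then Some (LEAST n. m \<le> n \<and> run f (pair x n) = Some 0)
     else None)"

lemma run_PMu: "run (PMu f) x = mu_from f x 0"
  by (simp add: mu_from_def)

text \<open>A search starting at \<open>m\<close> can be unfolded one candidate at a time, unlike
  \<open>PMu\<close>, which always starts at 0. This matches the frames with tag 4.\<close>

lemma mu_from_unfold:
  "mu_from f x m = Option.bind (run f (pair x m))
     (\<lambda>v. if v = 0 then Some m else mu_from f x (Suc m))"
proof (cases "run f (pair x m)")
  case None
  then have "\<not> (\<exists>n\<ge>m. run f (pair x n) = Some 0 \<and>
      (\<forall>l. m \<le> l \<and> l < n \<longrightarrow> run f (pair x l) \<noteq> None))"
    by (metis le_eq_less_or_eq option.distinct(1) order_refl)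
  with None show ?thesis by (simp add: mu_from_def)
next
  case (Some v)
  show ?thesis
  proof (cases "v = 0")
    case True
    have "(LEAST n. m \<le> n \<and> run f (pair x n) = Some 0) = m"
      by (rule Least_equality) (use Some True in auto)
    moreover have "\<exists>n\<ge>m. run f (pair x n) = Some 0 \<and>
        (\<forall>l. m \<le> l \<and> l < n \<longrightarrow> run f (pair x l) \<noteq> None)"
      using Some True by (intro exI[of _ m]) auto
    ultimately show ?thesis using Some True by (simp add: mu_from_def)
  next
    case False
    have tail: "m \<le> n \<and> run f (pair x n) = Some 0 \<longleftrightarrow> Suc m \<le> n \<and> run f (pair x n) = Some 0" for n
      using Some False by (cases "n = m") auto
    have "(\<exists>n\<ge>m. run f (pair x n) = Some 0 \<and> (\<forall>l. m \<le> l \<and> l < n \<longrightarrow> run f (pair x l) \<noteq> None)) \<longleftrightarrow>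
        (\<exists>n\<ge>Suc m. run f (pair x n) = Some 0 \<and> (\<forall>l. Suc m \<le> l \<and> l < n \<longrightarrow> run f (pair x l) \<noteq> None))"
      using Some tail by (metis Suc_leD not_less_eq_eq option.distinct(1) order_antisym)
    then have "mu_from f x m = mu_from f x (Suc m)" by (simp only: mu_from_def tail)
    then show ?thesis using Some False by simp
  qed
qed

lemma run_PRec: "run (PRec f g) x =
    (if rgt x = 0 then run f (lft x)
     else Option.bind (run (PRec f g) (pair (lft x) (rgt x - 1)))
       (\<lambda>v. run g (pair (lft x) (pair (rgt x - 1) v))))"
  by (cases "rgt x") (simp_all add: case_prod_beta)

text \<open>The denotational counterpart of \<open>ret_step\<close>: the effect of a pending frame
  on the value handed to it, as a partial function.\<close>

definition frame :: "nat \<Rightarrow> nat \<Rightarrow> nat option" where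
  "frame F y =
    (let t = lft F; p = lft (rgt F); q = rgt (rgt F) in
     if t = 0 then Option.bind (run (prog_of p) q) (\<lambda>w. Some (pair y w))
     else if t = 1 then Some (pair p y)
     else if t = 2 then run (prog_of p) y
     else if t = 3 then run (prog_of p) (pair (lft q) (pair (rgt q - 1) y))
     else if y = 0 then Some (rgt q)
     else mu_from (prog_of p) (lft q) (Suc (rgt q)))"

primrec frames :: "nat list \<Rightarrow> nat \<Rightarrow> nat option" where
  "frames [] = Some"
| "frames (F # Fs) = (\<lambda>y. Option.bind (frame F y) (frames Fs))"

text \<open>The final result that a state is bound to produce if its run ends. Its invariance under
  \<open>step\<close> shows that the machine returns only correct values.\<close>

definition denot :: "nat \<Rightarrow> nat option" where
  "denot s = (if lft s = 0
     then Option.bind (run (prog_of (lft (rgt s))) (lft (rgt (rgt s))))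
       (frames (list_decode (rgt (rgt (rgt s)))))
     else frames (list_decode (rgt (rgt s))) (lft (rgt s)))"

lemma denot_evl: "denot (evl e x K) = Option.bind (run (prog_of e) x) (frames (list_decode K))"
  by (simp add: denot_def evl_def)

lemma denot_ret: "denot (ret y K) = frames (list_decode K) y"
  by (simp add: denot_def ret_def)

lemma frames_push: "frames (list_decode (push t p q K)) y =
    Option.bind (frame (pair t (pair p q)) y) (frames (list_decode K))"
  by (simp add: push_def)

lemma denot_eval_step: "denot (eval_step e x K) = denot (evl e x K)"
proof -
  define k m a b where "k = lft e" "m = rgt e" "a = lft m" "b = rgt m"
  note defs = this
  have prog: "prog_of e =
     (if k = 0 then PZero
     else if k = 1 then PSucc
     else if k = 2 then PLeft
     else if k = 3 then PRight
     else if k = 4 then PPair (prog_of a) (prog_of b)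
     else if k = 5 then PComp (prog_of a) (prog_of b)
     else if k = 6 then PRec (prog_of a) (prog_of b)
     else PMu (prog_of m))"
    by (subst prog_of.simps) (simp add: Let_def defs)
  consider "k = 0" | "k = 1" | "k = 2" | "k = 3" | "k = 4" | "k = 5" | "k = 6" | "k > 6" by linarith
  then show ?thesis
  proof cases
    case 7
    then have p: "prog_of e = PRec (prog_of a) (prog_of b)" using prog by simp
    have "denot (eval_step e x K) = (if rgt x = 0 then denot (evl a (lft x) K)
        else denot (evl e (pair (lft x) (rgt x - 1)) (push 3 b x K)))"
      using 7 by (simp add: eval_step_def Let_def flip: defs)
    also have "\<dots> = Option.bind (run (prog_of e) x) (frames (list_decode K))"
      unfolding p denot_evl
      \<comment> \<open>The call at \<open>x\<close> is unfolded; the call at the predecessor stays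
        folded, since the machine also evaluates \<open>e\<close> itself there.\<close>
      by (subst (2) run_PRec)
        (auto simp del: run.simps simp: frames_push frame_def fun_eq_iff split: Option.bind_split)
    finally show ?thesis by (simp add: denot_evl)
  next
    case 8
    then have p: "prog_of e = PMu (prog_of m)" using prog by simp
    have "denot (eval_step e x K) = denot (evl m (pair x 0) (push 4 m (pair x 0) K))"
      using 8 by (simp add: eval_step_def Let_def flip: defs)
    also have "\<dots> = Option.bind (mu_from (prog_of m) x 0) (frames (list_decode K))"
      by (subst mu_from_unfold) (auto simp: denot_evl frames_push frame_def split: Option.bind_split)
    finally show ?thesis by (simp only: denot_evl p run_PMu)
  qed (auto simp: eval_step_def Let_def prog denot_evl denot_ret frames_push frame_def
      split: Option.bind_split simp flip: defs)
qed

lemma denot_ret_step: "denot (ret_step y K) = denot (ret y K)"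
proof (cases "K = 0")
  case True
  then show ?thesis by (simp add: ret_step_def)
next
  case False
  define F R t p q where "F = lft (K - 1)" "R = rgt (K - 1)" "t = lft F" "p = lft (rgt F)" "q = rgt (rgt F)"
  note defs = this
  have K: "list_decode K = F # list_decode R"
    using False by (cases K) (simp_all add: defs case_prod_beta)
  have step: "ret_step y K = (if t = 0 then evl p q (push 1 y 0 R)
     else if t = 1 then ret (pair p y) R
     else if t = 2 then evl p y R
     else if t = 3 then evl p (pair (lft q) (pair (rgt q - 1) y)) R
     else if y = 0 then ret (rgt q) R
     else evl p (pair (lft q) (Suc (rgt q))) (push 4 p (pair (lft q) (Suc (rgt q))) R))"
    using False by (simp add: ret_step_def Let_def defs)
  have frame: "frame F y = (if t = 0 then Option.bind (run (prog_of p) q) (\<lambda>w. Some (pair y w))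
     else if t = 1 then Some (pair p y)
     else if t = 2 then run (prog_of p) y
     else if t = 3 then run (prog_of p) (pair (lft q) (pair (rgt q - 1) y))
     else if y = 0 then Some (rgt q)
     else mu_from (prog_of p) (lft q) (Suc (rgt q)))"
    by (simp add: frame_def Let_def defs)
  \<comment> \<open>A state testing candidate \<open>n\<close> denotes the entire remaining search
    from \<open>n\<close> on.\<close>
  have mu: "denot (evl p (pair a n) (push 4 p (pair a n) R)) =
      Option.bind (mu_from (prog_of p) a n) (frames (list_decode R))" for a n
    by (subst mu_from_unfold) (auto simp: denot_evl frames_push frame_def split: Option.bind_split)
  show ?thesis
  proof (cases "t \<in> {0, 1, 2, 3} \<or> y = 0")
    case True
    then show ?thesis
      by (auto simp: step frame denot_ret K denot_evl frames_push)
        (auto simp: frame_def frames_push split: Option.bind_split)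
  next
    case False
    then show ?thesis by (simp add: step frame mu denot_ret K)
  qed
qed

lemma denot_step: "denot (step s) = denot s"
proof (cases "lft s = 0")
  case True
  then show ?thesis by (simp add: step_def denot_eval_step) (simp add: denot_def evl_def)
next
  case False
  then show ?thesis by (simp add: step_def denot_ret_step) (simp add: denot_def ret_def)
qed

lemma denot_funpow: "denot ((step ^^ n) s) = denot s"
  by (induction n) (simp_all add: denot_step)

section \<open>Completeness of the machine and the normal form theorem\<close>

abbreviation reaches :: "nat \<Rightarrow> nat \<Rightarrow> bool" where
  "reaches \<equiv> iterates_to step"

text \<open>Invariance of \<open>denot\<close> does not exclude an endless run; this does. The stack
  \<open>K\<close> is arbitrary so that the induction applies to subprograms evaluated below
  additional frames.\<close>

lemma reaches_ret:
  "run (prog_of e) x = Some y \<Longrightarrow> reaches (evl e x K) (ret y K)"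
proof (induction e arbitrary: x y K rule: prog_of.induct)
  case (1 e)
  define k m a b where "k = lft e" "m = rgt e" "a = lft m" "b = rgt m"
  note defs = this
  note prems = "1.prems"
  note IH = "1.IH"[OF defs]
  have IHa: "reaches (evl a z K') (ret v K')"
    if k: "k = 4 \<or> k = 5 \<or> k = 6" and z: "run (prog_of a) z = Some v" for z v K'
    using k
  proof (elim disjE)
    assume "k = 4" then show ?thesis by (intro IH(1)) (simp_all add: z)
  next
    assume "k = 5" then show ?thesis by (intro IH(3)) (simp_all add: z)
  next
    assume "k = 6" then show ?thesis by (intro IH(5)) (simp_all add: z)
  qed
  have IHb: "reaches (evl b z K') (ret v K')"
    if k: "k = 4 \<or> k = 5 \<or> k = 6" and z: "run (prog_of b) z = Some v" for z v K'
    using k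
  proof (elim disjE)
    assume "k = 4" then show ?thesis by (intro IH(2)) (simp_all add: z)
  next
    assume "k = 5" then show ?thesis by (intro IH(4)) (simp_all add: z)
  next
    assume "k = 6" then show ?thesis by (intro IH(6)) (simp_all add: z)
  qed
  have prog: "prog_of e =
     (if k = 0 then PZero
     else if k = 1 then PSucc
     else if k = 2 then PLeft
     else if k = 3 then PRight
     else if k = 4 then PPair (prog_of a) (prog_of b)
     else if k = 5 then PComp (prog_of a) (prog_of b)
     else if k = 6 then PRec (prog_of a) (prog_of b)
     else PMu (prog_of m))"
    by (subst prog_of.simps) (simp add: Let_def defs)
  note estep = eval_step_def[of e, unfolded Let_def, folded defs]
  consider "k = 0" | "k = 1" | "k = 2" | "k = 3" | "k = 4" | "k = 5" | "k = 6" | "k > 6" by linarith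
  then show ?case
  proof cases
    case 1
    then have "prog_of e = PZero" using prog by simp
    then have "y = 0" using prems by simp
    with 1 show ?thesis
      by (intro iterates_to_step[OF iterates_to_eq]) (simp add: step_evl estep)
  next
    case 2
    then have "prog_of e = PSucc" using prog by simp
    then have "y = Suc x" using prems by simp
    with 2 show ?thesis
      by (intro iterates_to_step[OF iterates_to_eq]) (simp add: step_evl estep)
  next
    case 3
    then have "prog_of e = PLeft" using prog by simp
    then have "y = lft x" using prems by simp
    with 3 show ?thesis
      by (intro iterates_to_step[OF iterates_to_eq]) (simp add: step_evl estep)
  next
    case 4
    then have "prog_of e = PRight" using prog by simp
    then have "y = rgt x" using prems by simp
    with 4 show ?thesis
      by (intro iterates_to_step[OF iterates_to_eq]) (simp add: step_evl estep)
  next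
    case 5
    then have p: "prog_of e = PPair (prog_of a) (prog_of b)" using prog by simp
    obtain u v where uv: "run (prog_of a) x = Some u" "run (prog_of b) x = Some v" "y = pair u v"
      using prems unfolding p by (auto simp: bind_eq_Some_conv)
    have "reaches (evl a x (push 0 b x K)) (ret u (push 0 b x K))" by (rule IHa) (use 5 uv in simp_all)
    also have "reaches (ret u (push 0 b x K)) (evl b x (push 1 u 0 K))"
      by (rule iterates_to_step) (simp add: step_ret ret_step_def push_def iterates_to_refl)
    also have "reaches (evl b x (push 1 u 0 K)) (ret v (push 1 u 0 K))" by (rule IHb) (use 5 uv in simp_all)
    also have "reaches (ret v (push 1 u 0 K)) (ret y K)"
      by (rule iterates_to_step) (simp add: step_ret ret_step_def push_def iterates_to_refl uv)
    finally show ?thesis using 5 by (intro iterates_to_step[of step "evl e x K"]) (simp add: step_evl estep)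
  next
    case 6
    then have p: "prog_of e = PComp (prog_of a) (prog_of b)" using prog by simp
    obtain u where u: "run (prog_of b) x = Some u" "run (prog_of a) u = Some y"
      using prems unfolding p run.simps bind_eq_Some_conv by blast
    have "reaches (evl b x (push 2 a 0 K)) (ret u (push 2 a 0 K))" by (rule IHb) (use 6 u in simp_all)
    also have "reaches (ret u (push 2 a 0 K)) (evl a u K)"
      by (rule iterates_to_step) (simp add: step_ret ret_step_def push_def iterates_to_refl)
    also have "reaches (evl a u K) (ret y K)" by (rule IHa) (use 6 u in simp_all)
    finally show ?thesis using 6 by (intro iterates_to_step[of step "evl e x K"]) (simp add: step_evl estep)
  next
    case 7
    then have p: "prog_of e = PRec (prog_of a) (prog_of b)" using prog by simp
    \<comment> \<open>The machine evaluates the same index \<open>e\<close> at the predecessor,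
      which the induction on indices does not cover; an inner induction on the recursion depth
      does.\<close>
    have "run (PRec (prog_of a) (prog_of b)) (pair c n) = Some z \<Longrightarrow>
        reaches (evl e (pair c n) K') (ret z K')" for c n z K'
    proof (induction n arbitrary: z K')
      case 0
      then have "reaches (evl a c K') (ret z K')" using 7 by (intro IHa) simp_all
      then show ?case using 7 by (intro iterates_to_step[of step "evl e _ _"]) (simp add: step_evl estep)
    next
      case (Suc n)
      then obtain v where v: "run (PRec (prog_of a) (prog_of b)) (pair c n) = Some v"
        "run (prog_of b) (pair c (pair n v)) = Some z"
        by (auto simp: bind_eq_Some_conv)
      let ?K = "push 3 b (pair c (Suc n)) K'"
      have "reaches (evl e (pair c n) ?K) (ret v ?K)" by (rule Suc.IH[OF v(1)])
      also have "reaches (ret v ?K) (evl b (pair c (pair n v)) K')"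
        by (rule iterates_to_step) (simp add: step_ret ret_step_def push_def iterates_to_refl)
      also have "reaches \<dots> (ret z K')" by (rule IHb) (use 7 v in simp_all)
      finally show ?case using 7 by (intro iterates_to_step[of step "evl e _ _"]) (simp add: step_evl estep)
    qed
    from this[of "lft x" "rgt x"] prems show ?thesis by (simp add: p del: run.simps)
  next
    case 8
    then have p: "prog_of e = PMu (prog_of m)" using prog by simp
    let ?r = "\<lambda>n. run (prog_of m) (pair x n)"
    obtain n where n: "?r n = Some 0" "\<forall>l<n. ?r l \<noteq> None" and y: "y = (LEAST n. ?r n = Some 0)"
      using prems p by (auto split: if_splits)
    have y0: "?r y = Some 0" unfolding y using n(1) by (rule LeastI)
    have "y \<le> n" unfolding y using n(1) by (rule Least_le)
    have below: "\<exists>v. ?r l = Some v \<and> v \<noteq> 0" if "l < y" for l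
    proof -
      have "?r l \<noteq> None" using n(2) that \<open>y \<le> n\<close> by auto
      moreover have "?r l \<noteq> Some 0" using that unfolding y by (rule not_less_Least)
      ultimately show ?thesis by auto
    qed
    have body: "reaches (evl m z K') (ret v K')" if "run (prog_of m) z = Some v" for z v K'
      by (rule IH(7)) (use 8 that in simp_all)
    \<comment> \<open>Induction backwards from the least zero \<open>y\<close>: \<open>d\<close>
      counts the candidates still to be rejected.\<close>
    have "reaches (evl m (pair x (y - d)) (push 4 m (pair x (y - d)) K)) (ret y K)" if "d \<le> y" for d
      using that
    proof (induction d)
      case 0
      have "reaches (evl m (pair x y) (push 4 m (pair x y) K)) (ret 0 (push 4 m (pair x y) K))"
        by (rule body[OF y0])
      also have "reaches \<dots> (ret y K)"
        by (rule iterates_to_step) (simp add: step_ret ret_step_def push_def iterates_to_refl)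
      finally show ?case by simp
    next
      case (Suc d)
      let ?l = "y - Suc d"
      have l: "Suc ?l = y - d" using Suc.prems by simp
      obtain v where v: "?r ?l = Some v" "v \<noteq> 0" using below[of ?l] Suc.prems by auto
      have "reaches (evl m (pair x ?l) (push 4 m (pair x ?l) K)) (ret v (push 4 m (pair x ?l) K))"
        by (rule body[OF v(1)])
      also have "reaches \<dots> (evl m (pair x (Suc ?l)) (push 4 m (pair x (Suc ?l)) K))"
        using v(2) by (intro iterates_to_step[of step "ret v _"]) (simp add: step_ret ret_step_def push_def iterates_to_refl)
      also have "reaches \<dots> (ret y K)" unfolding l using Suc by simp
      finally show ?case .
    qed
    from this[of y] show ?thesis
      using 8 by (intro iterates_to_step[of step "evl e x K"]) (simp add: step_evl estep)
  qed
qed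

text \<open>A total stage function: 0 means that no value has been returned to the empty stack at
  stage \<open>n\<close>, and a result \<open>y\<close> is reported as \<open>Suc y\<close>.\<close>

definition halt :: "nat \<Rightarrow> nat \<Rightarrow> nat \<Rightarrow> nat" where
  "halt e x n = (let s = (step ^^ n) (evl e x 0) in
     if lft s = 1 then if rgt (rgt s) = 0 then Suc (lft (rgt s)) else 0 else 0)"

lemma computable_halt:
  assumes "computable e" "computable x" "computable n"
  shows "computable (\<lambda>z. halt (e z) (x z) (n z))"
  unfolding halt_def Let_def evl_def
  by (intro computable_intros computable_funpow computable_step assms)

text \<open>Kleene's normal form. One direction is \<open>reaches_ret\<close> with the empty stack,
  the other the invariance of \<open>denot\<close>.\<close>

theorem run_eq_Some_iff: "run (prog_of e) x = Some y \<longleftrightarrow> (\<exists>n. halt e x n = Suc y)"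
proof
  assume "run (prog_of e) x = Some y"
  then obtain n where "(step ^^ n) (evl e x 0) = ret y 0"
    using reaches_ret unfolding iterates_to_def by blast
  then have "halt e x n = Suc y" by (simp add: halt_def ret_def)
  then show "\<exists>n. halt e x n = Suc y" ..
next
  assume "\<exists>n. halt e x n = Suc y"
  then obtain n where n: "halt e x n = Suc y" ..
  define s where "s = (step ^^ n) (evl e x 0)"
  have "lft s = 1" "rgt (rgt s) = 0" "lft (rgt s) = y"
    using n by (auto simp: halt_def s_def Let_def split: if_splits)
  then have "denot s = Some y" by (simp add: denot_def)
  then have "denot (evl e x 0) = Some y" by (simp add: s_def denot_funpow)
  then show "run (prog_of e) x = Some y" by (simp add: denot_evl bind_eq_Some_conv)
qed

lemma mem_W_iff: "x \<in> W e \<longleftrightarrow> (\<exists>n. halt e x n \<noteq> 0)"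
proof -
  have "x \<in> W e \<longleftrightarrow> (\<exists>y. run (prog_of e) x = Some y)" by (auto simp: W_def)
  also have "\<dots> \<longleftrightarrow> (\<exists>n. halt e x n \<noteq> 0)"
    unfolding run_eq_Some_iff by (metis not0_implies_Suc nat.distinct(1))
  finally show ?thesis .
qed

section \<open>The recursion theorem\<close>

lemma prog_of_pair: "prog_of (pair 4 (pair a b)) = PPair (prog_of a) (prog_of b)"
    "prog_of (pair 5 (pair a b)) = PComp (prog_of a) (prog_of b)"
  by (simp_all add: prog_of.simps[of "prod_encode x" for x] Let_def)

text \<open>An index of the constant function \<open>c\<close>, obtained by composing
  \<open>PSucc\<close> with \<open>PZero\<close> repeatedly. It is built on indices so as to be
  computable in \<open>c\<close>.\<close>

definition const_num :: "nat \<Rightarrow> nat" where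
  "const_num c = ((\<lambda>m. pair 5 (pair (prog_num PSucc) m)) ^^ c) (prog_num PZero)"

lemma run_const_num: "run (prog_of (const_num c)) x = Some c"
proof (induction c)
  case 0
  then show ?case unfolding const_num_def by (simp only: funpow_0 prog_of_prog_num) simp
next
  case (Suc c)
  have "const_num (Suc c) = pair 5 (pair (prog_num PSucc) (const_num c))"
    by (simp add: const_num_def)
  with Suc show ?case by (simp add: prog_of_pair prog_of_prog_num del: prog_num.simps)
qed

text \<open>The s-m-n function: an index of program \<open>e\<close> composed with the map sending
  \<open>x\<close> to \<open>pair c x\<close>.\<close>

definition smn :: "nat \<Rightarrow> nat \<Rightarrow> nat" where
  "smn e c = pair 5 (pair e (pair 4 (pair (const_num c) (prog_num (PPair PLeft PRight)))))"

lemma run_smn: "run (prog_of (smn e c)) x = run (prog_of e) (pair c x)"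
  by (simp add: smn_def prog_of_pair run_const_num prog_of_prog_num del: prog_num.simps)

lemma computable_smn:
  assumes "computable e" "computable c"
  shows "computable (\<lambda>x. smn (e x) (c x))"
  unfolding smn_def const_num_def
  by (intro computable_intros computable_funpow assms)

theorem recursion_theorem:
  assumes "partial_computable \<Theta>"
  obtains \<kappa> where "computable \<kappa>" "\<And>c x. run (prog_of (\<kappa> c)) x = \<Theta> (pair (\<kappa> c) (pair c x))"
proof -
  \<comment> \<open>For \<open>y = pair (pair q c) x\<close>, \<open>?s y\<close> is the index of
    program \<open>q\<close> supplied with its own index and \<open>c\<close>. Choosing for
    \<open>q\<close> the index \<open>?e\<close> of the function that passes \<open>?s y\<close> to
    \<Theta> closes the loop.\<close>
  let ?s = "\<lambda>y. smn (lft (lft y)) (lft y)"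
  have "partial_computable (\<lambda>y. \<Theta> (pair (?s y) (pair (rgt (lft y)) (rgt y))))"
    by (intro partial_computable_comp[OF assms] computable_intros computable_smn)
  then obtain p where p: "run p = (\<lambda>y. \<Theta> (pair (?s y) (pair (rgt (lft y)) (rgt y))))"
    by (auto simp: partial_computable_def)
  let ?e = "prog_num p"
  show ?thesis
  proof
    show "computable (\<lambda>c. smn ?e (pair ?e c))"
      by (intro computable_smn computable_intros)
    show "run (prog_of (smn ?e (pair ?e c))) x =
        \<Theta> (pair (smn ?e (pair ?e c)) (pair c x))" for c x
      by (simp add: run_smn prog_of_prog_num p)
  qed
qed

text \<open>The set adjoins to \<open>W u\<close> at most one element, which \<open>D\<close> may
  compute from the very index of the resulting set.\<close>

lemma self_referential_adjoin:
  assumes "partial_computable D"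
  obtains \<kappa> where "computable \<kappa>" "\<And>c. W (\<kappa> c) = W u \<union> {z. D (pair (\<kappa> c) c) = Some z}"
proof -
  obtain p where p: "run p = D"
    using assms by (auto simp: partial_computable_def)
  define d where "d = prog_num p"
  have d: "D y = Some z \<longleftrightarrow> (\<exists>n. halt d y n = Suc z)" for y z
    by (simp add: d_def prog_of_prog_num p flip: run_eq_Some_iff)
  \<comment> \<open>\<open>w\<close> codes own index \<open>k\<close>, parameter \<open>c\<close>,
    candidate \<open>x\<close> and stage \<open>s\<close>; a zero means that by stage
    \<open>s\<close> either \<open>x\<close> has entered \<open>W u\<close> or \<open>D\<close> has
    output exactly \<open>x\<close>.\<close>
  define h where "h w = (let k = lft (lft w); c = lft (rgt (lft w)); x = rgt (rgt (lft w)); s = rgt w in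
    if halt u x s = 0 then if halt d (pair k c) s = Suc x then 0 else 1 else (0::nat))" for w
  have "computable h"
    unfolding h_def Let_def by (intro computable_intros computable_halt)
  then obtain \<kappa> where
    \<kappa>: "computable \<kappa>" "\<And>c x. run (prog_of (\<kappa> c)) x = search h (pair (\<kappa> c) (pair c x))"
    using recursion_theorem[OF partial_computable_search] by blast
  have "x \<in> W (\<kappa> c) \<longleftrightarrow> (\<exists>s. halt u x s \<noteq> 0 \<or> halt d (pair (\<kappa> c) c) s = Suc x)" for x c
    by (auto simp: W_def \<kappa>(2) search_None h_def Let_def simp del: not_None_eq)
  then have "W (\<kappa> c) = W u \<union> {z. D (pair (\<kappa> c) c) = Some z}" for c
    by (auto simp: mem_W_iff d)
  with \<kappa>(1) show ?thesis by (rule that)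
qed


section \<open>Recognizing sentences\<close>

text \<open>
  A stack of tasks, with frames \<open>push k d q\<close>: for \<open>k = 0\<close> and \<open>k = 1\<close>, the task is to check that
  \<open>q\<close> codes a formula, respectively a term, all of whose free variables are below \<open>d\<close>; otherwise
  that \<open>q = pair a b\<close> where \<open>b\<close> codes a list of \<open>a\<close> such terms.  A failed check leaves the stack
  unchanged, so that it is never emptied.
\<close>

definition arity_code :: "nat option \<Rightarrow> nat" where
  "arity_code v = (case v of None \<Rightarrow> 0 | Some k \<Rightarrow> Suc k)"

definition check_step :: "signature \<Rightarrow> nat \<Rightarrow> nat" where
  "check_step L s =
    (if s = 0 then 0 else
     let F = lft (s - 1); r = rgt (s - 1); k = lft F; d = lft (rgt F); q = rgt (rgt F);
         a = lft q; b = rgt q in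
     if k = 0 then
       (if a = 0 then push 1 d (lft b) (push 1 d (rgt b) r)
        else if a = 1 then
          (if arity_code (rel_arity L (lft b)) = 0 then s
           else push 2 d (pair (arity_code (rel_arity L (lft b)) - 1) (rgt b)) r)
        else if a = 2 then push 0 d b r
        else if a = 3 then push 0 d (lft b) (push 0 d (rgt b) r)
        else if a = 4 then push 0 (Suc d) b r
        else s)
     else if k = 1 then
       (if a = 0 then if Suc b - d = 0 then r else s
        else if a = 1 then
          (if arity_code (fun_arity L (lft b)) = 0 then s
           else push 2 d (pair (arity_code (fun_arity L (lft b)) - 1) (rgt b)) r)
        else s)
     else if b = 0 then if a = 0 then r else s
     else if a = 0 then s
     else push 1 d (lft (b - 1)) (push 2 d (pair (a - 1) (rgt (b - 1))) r))"

lemma computable_check_step: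
  assumes "effective_signature L"
  shows "computable (check_step L)"
proof -
  have "computable (\<lambda>n. arity_code (fun_arity L n))" "computable (\<lambda>n. arity_code (rel_arity L n))"
    using assms by (simp_all add: effective_signature_def arity_code_def)
  note arity = this[THEN computable_comp]
  show ?thesis
    unfolding check_step_def[abs_def] push_def Let_def by (intro computable_intros arity)
qed

section \<open>Soundness and completeness of the check\<close>

definition valid_task :: "signature \<Rightarrow> nat \<Rightarrow> nat \<Rightarrow> nat \<Rightarrow> bool" where
  "valid_task L k d q \<longleftrightarrow>
    (if k = 0 then \<exists>p. gn p = q \<and> wf_fm L p \<and> fv p \<subseteq> {..<d}
     else if k = 1 then \<exists>t. tm_num t = q \<and> wf_tm L t \<and> fv_tm t \<subseteq> {..<d}
     else \<exists>ts. list_encode (map tm_num ts) = rgt q \<and> length ts = lft q \<and>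
       (\<forall>t\<in>set ts. wf_tm L t \<and> fv_tm t \<subseteq> {..<d}))"

definition valid_stack :: "signature \<Rightarrow> nat \<Rightarrow> bool" where
  "valid_stack L s \<longleftrightarrow> (\<forall>F\<in>set (list_decode s). valid_task L (lft F) (lft (rgt F)) (rgt (rgt F)))"

lemma valid_stack_0: "valid_stack L 0"
  by (simp add: valid_stack_def)

lemma valid_stack_push: "valid_stack L (push k d q r) \<longleftrightarrow> valid_task L k d q \<and> valid_stack L r"
  by (simp add: valid_stack_def push_def)

lemma push_cases:
  assumes "s \<noteq> 0"
  obtains k d q r where "s = push k d q r"
proof -
  from assms have "s = push (lft (lft (s - 1))) (lft (rgt (lft (s - 1)))) (rgt (rgt (lft (s - 1)))) (rgt (s - 1))"
    by (simp add: push_def)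
  then show ?thesis by (rule that)
qed

lemma pair_cases: obtains a b where "q = pair a b"
  by (metis prod_decode_inverse surj_pair)

text \<open>The same step read on an explicit top frame, with arity codes and truncated subtraction
  replaced by \<open>case\<close> and \<open><\<close>.\<close>

lemma check_step_push: "check_step L (push k d (pair a b) r) =
    (if k = 0 then
       (if a = 0 then push 1 d (lft b) (push 1 d (rgt b) r)
        else if a = 1 then
          (case rel_arity L (lft b) of None \<Rightarrow> push k d (pair a b) r
           | Some m \<Rightarrow> push 2 d (pair m (rgt b)) r)
        else if a = 2 then push 0 d b r
        else if a = 3 then push 0 d (lft b) (push 0 d (rgt b) r)
        else if a = 4 then push 0 (Suc d) b r
        else push k d (pair a b) r)
     else if k = 1 then
       (if a = 0 then if b < d then r else push k d (pair a b) r
        else if a = 1 then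
          (case fun_arity L (lft b) of None \<Rightarrow> push k d (pair a b) r
           | Some m \<Rightarrow> push 2 d (pair m (rgt b)) r)
        else push k d (pair a b) r)
     else if b = 0 then if a = 0 then r else push k d (pair a b) r
     else if a = 0 then push k d (pair a b) r
     else push 1 d (lft (b - 1)) (push 2 d (pair (a - 1) (rgt (b - 1))) r))"
  by (auto simp: check_step_def Let_def arity_code_def push_def split: option.split)

lemma valid_task_formula:
  "valid_task L 1 d a \<Longrightarrow> valid_task L 1 d b \<Longrightarrow> valid_task L 0 d (pair 0 (pair a b))"
  "valid_task L 2 d (pair m b) \<Longrightarrow> rel_arity L a = Some m \<Longrightarrow> valid_task L 0 d (pair 1 (pair a b))"
  "valid_task L 0 d a \<Longrightarrow> valid_task L 0 d (pair 2 a)"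
  "valid_task L 0 d a \<Longrightarrow> valid_task L 0 d b \<Longrightarrow> valid_task L 0 d (pair 3 (pair a b))"
  "valid_task L 0 (Suc d) a \<Longrightarrow> valid_task L 0 d (pair 4 a)"
proof -
  show "valid_task L 0 d (pair 0 (pair a b))" if "valid_task L 1 d a" "valid_task L 1 d b"
  proof -
    from that obtain s t where "tm_num s = a" "wf_tm L s" "fv_tm s \<subseteq> {..<d}"
      "tm_num t = b" "wf_tm L t" "fv_tm t \<subseteq> {..<d}"
      by (auto simp: valid_task_def)
    then show ?thesis by (auto simp: valid_task_def subset_eq intro!: exI[of _ "Eq s t"])
  qed
  show "valid_task L 0 d (pair 1 (pair a b))" if "valid_task L 2 d (pair m b)" "rel_arity L a = Some m"
  proof -
    from that obtain ts where "list_encode (map tm_num ts) = b" "length ts = m"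
      "\<forall>t\<in>set ts. wf_tm L t \<and> fv_tm t \<subseteq> {..<d}"
      by (auto simp: valid_task_def)
    then show ?thesis using that(2)
      by (auto simp: valid_task_def subset_eq intro!: exI[of _ "Rel a ts"])
  qed
  show "valid_task L 0 d (pair 2 a)" if "valid_task L 0 d a"
  proof -
    from that obtain p where "gn p = a" "wf_fm L p" "fv p \<subseteq> {..<d}"
      by (auto simp: valid_task_def)
    then show ?thesis by (auto simp: valid_task_def subset_eq intro!: exI[of _ "Neg p"])
  qed
  show "valid_task L 0 d (pair 3 (pair a b))" if "valid_task L 0 d a" "valid_task L 0 d b"
  proof -
    from that obtain p q where "gn p = a" "wf_fm L p" "fv p \<subseteq> {..<d}"
      "gn q = b" "wf_fm L q" "fv q \<subseteq> {..<d}"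
      by (auto simp: valid_task_def)
    then show ?thesis by (auto simp: valid_task_def subset_eq intro!: exI[of _ "Imp p q"])
  qed
  show "valid_task L 0 d (pair 4 a)" if "valid_task L 0 (Suc d) a"
  proof -
    from that obtain p where "gn p = a" "wf_fm L p" "fv p \<subseteq> {..<Suc d}"
      by (auto simp: valid_task_def)
    then show ?thesis by (auto simp: valid_task_def subset_eq intro!: exI[of _ "All p"])
  qed
qed

lemma valid_task_term:
  "a < d \<Longrightarrow> valid_task L 1 d (pair 0 a)"
  "valid_task L 2 d (pair m b) \<Longrightarrow> fun_arity L a = Some m \<Longrightarrow> valid_task L 1 d (pair 1 (pair a b))"
proof -
  show "valid_task L 1 d (pair 0 a)" if "a < d"
    using that by (auto simp: valid_task_def subset_eq intro!: exI[of _ "Var a"])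
  show "valid_task L 1 d (pair 1 (pair a b))" if "valid_task L 2 d (pair m b)" "fun_arity L a = Some m"
  proof -
    from that obtain ts where "list_encode (map tm_num ts) = b" "length ts = m"
      "\<forall>t\<in>set ts. wf_tm L t \<and> fv_tm t \<subseteq> {..<d}"
      by (auto simp: valid_task_def)
    then show ?thesis using that(2)
      by (auto simp: valid_task_def subset_eq intro!: exI[of _ "Fun a ts"])
  qed
qed

lemma valid_task_list:
  "k \<noteq> 0 \<Longrightarrow> k \<noteq> 1 \<Longrightarrow> valid_task L k d (pair 0 0)"
  "k \<noteq> 0 \<Longrightarrow> k \<noteq> 1 \<Longrightarrow> valid_task L 1 d a \<Longrightarrow> valid_task L 2 d (pair m b) \<Longrightarrow> valid_task L k d (pair (Suc m) (Suc (pair a b)))"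
proof -
  show "valid_task L k d (pair 0 0)" if "k \<noteq> 0" "k \<noteq> 1"
    using that by (auto simp: valid_task_def)
  show "valid_task L k d (pair (Suc m) (Suc (pair a b)))"
    if "k \<noteq> 0" "k \<noteq> 1" "valid_task L 1 d a" "valid_task L 2 d (pair m b)"
  proof -
    from that obtain t ts where "tm_num t = a" "wf_tm L t" "fv_tm t \<subseteq> {..<d}"
      "list_encode (map tm_num ts) = b" "length ts = m"
      "\<forall>t\<in>set ts. wf_tm L t \<and> fv_tm t \<subseteq> {..<d}"
      by (auto simp: valid_task_def)
    then show ?thesis using that(1,2)
      by (auto simp: valid_task_def subset_eq intro!: exI[of _ "t # ts"])
  qed
qed

text \<open>Validity is pulled back along a step: either the stack is unchanged, or the tasks
  replacing the top one imply it. From the empty stack it thus spreads to every stack that gets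
  emptied.\<close>

lemma valid_stack_check_step:
  assumes "valid_stack L (check_step L s)"
  shows "valid_stack L s"
proof (cases "s = 0")
  case False
  then obtain k d q r where s: "s = push k d q r" by (rule push_cases)
  obtain a b where q: "q = pair a b" by (rule pair_cases)
  note * = assms[unfolded s q check_step_push]
  consider "k = 0" | "k = 1" | "k \<noteq> 0" "k \<noteq> 1" by blast
  then have "valid_stack L (push k d q r)"
  proof cases
    case 1
    obtain b1 b2 where "b = pair b1 b2" by (rule pair_cases)
    with * 1 q show ?thesis
      by (auto simp: valid_stack_push intro: valid_task_formula[unfolded One_nat_def]
          split: if_splits option.splits)
  next
    case 2
    obtain b1 b2 where "b = pair b1 b2" by (rule pair_cases)
    with * 2 q show ?thesis
      by (auto simp: valid_stack_push intro: valid_task_term[unfolded One_nat_def]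
          split: if_splits option.splits)
  next
    case 3
    have "b = 0 \<or> (\<exists>x y. b = Suc (pair x y))"
      by (metis not0_implies_Suc pair_cases)
    with * 3 q show ?thesis
      by (auto simp: valid_stack_push gr0_conv_Suc intro: valid_task_list[unfolded One_nat_def]
          split: if_splits)
  qed
  then show ?thesis by (simp only: s)
qed (simp add: valid_stack_0)

lemma valid_stack_if_iterates_to_0:
  assumes "iterates_to (check_step L) s 0"
  shows "valid_stack L s"
proof -
  from assms obtain n where "(check_step L ^^ n) s = 0"
    by (auto simp: iterates_to_def)
  then show ?thesis
  proof (induction n arbitrary: s)
    case 0
    then show ?case by (simp add: valid_stack_0)
  next
    case (Suc n)
    then have "(check_step L ^^ n) (check_step L s) = 0"
      by (simp only: funpow_Suc_right comp_apply)
    then show ?case by (rule valid_stack_check_step[OF Suc.IH])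
  qed
qed

text \<open>The checks of the members are a premise, so that the lemma can serve inside the
  induction on terms. The remainder \<open>r\<close> varies because the head is checked above the
  task for the tail.\<close>

lemma check_list:
  assumes "\<And>t r. t \<in> set ts \<Longrightarrow> iterates_to (check_step L) (push 1 d (tm_num t) r) r"
  shows "iterates_to (check_step L) (push 2 d (pair (length ts) (list_encode (map tm_num ts))) r) r"
  using assms
proof (induction ts)
  case Nil
  show ?case by (rule iterates_to_step[OF iterates_to_eq]) (simp add: check_step_push)
next
  case (Cons t ts)
  let ?r = "push 2 d (pair (length ts) (list_encode (map tm_num ts))) r"
  have "iterates_to (check_step L) (push 1 d (tm_num t) ?r) ?r"
    by (rule Cons.prems) simp
  also have "iterates_to (check_step L) ?r r"
    by (rule Cons.IH) (rule Cons.prems, simp)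
  finally show ?case by - (rule iterates_to_step, simp add: check_step_push)
qed

lemma check_term:
  "wf_tm L t \<Longrightarrow> fv_tm t \<subseteq> {..<d} \<Longrightarrow> iterates_to (check_step L) (push 1 d (tm_num t) r) r"
proof (induction t arbitrary: r)
  case (Var n)
  then show ?case by (intro iterates_to_step[OF iterates_to_eq]) (simp add: check_step_push)
next
  case (Fun f ts)
  then have "iterates_to (check_step L) (push 2 d (pair (length ts) (list_encode (map tm_num ts))) r) r"
    by (intro check_list) (auto simp: UN_subset_iff)
  with Fun.prems show ?case by - (rule iterates_to_step, simp add: check_step_push)
qed

lemma check_formula:
  "wf_fm L p \<Longrightarrow> fv p \<subseteq> {..<d} \<Longrightarrow> iterates_to (check_step L) (push 0 d (gn p) r) r"
proof (induction p arbitrary: d r)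
  case (Eq s t)
  have "iterates_to (check_step L) (push 1 d (tm_num s) (push 1 d (tm_num t) r)) (push 1 d (tm_num t) r)"
    using Eq by (intro check_term) auto
  also have "iterates_to (check_step L) (push 1 d (tm_num t) r) r"
    using Eq by (intro check_term) auto
  finally show ?case by - (rule iterates_to_step, simp add: check_step_push)
next
  case (Rel f ts)
  then have "iterates_to (check_step L) (push 2 d (pair (length ts) (list_encode (map tm_num ts))) r) r"
    by (intro check_list check_term) (auto simp: UN_subset_iff)
  with Rel.prems show ?case by - (rule iterates_to_step, simp add: check_step_push)
next
  case (Neg p)
  then have "iterates_to (check_step L) (push 0 d (gn p) r) r" by simp
  then show ?case by - (rule iterates_to_step, simp add: check_step_push)
next
  case (Imp p q)
  have "iterates_to (check_step L) (push 0 d (gn p) (push 0 d (gn q) r)) (push 0 d (gn q) r)"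
    using Imp by simp
  also have "iterates_to (check_step L) (push 0 d (gn q) r) r"
    using Imp by simp
  finally show ?case by - (rule iterates_to_step, simp add: check_step_push)
next
  case (All p)
  \<comment> \<open>Index 0 is bound by the quantifier, and \<open>Suc n\<close> inside it is the
    index \<open>n\<close> outside.\<close>
  have "fv p \<subseteq> {..<Suc d}"
  proof
    fix n assume "n \<in> fv p"
    with All.prems show "n \<in> {..<Suc d}" by (cases n) auto
  qed
  with All have "iterates_to (check_step L) (push 0 (Suc d) (gn p) r) r" by simp
  then show ?case by - (rule iterates_to_step, simp add: check_step_push)
qed

lemma sentence_semidecidable:
  assumes "effective_signature L"
  obtains \<sigma> where "partial_computable \<sigma>" "\<And>n. \<sigma> n \<noteq> None \<longleftrightarrow> n \<in> gn ` sentences L"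
proof
  \<comment> \<open>The initial stack has a single task; its bound 0 on free variables makes the
    formula closed.\<close>
  let ?h = "\<lambda>w. (check_step L ^^ rgt w) (push 0 0 (lft w) 0)"
  have "computable ?h"
    unfolding push_def by (intro computable_funpow computable_check_step assms computable_intros)
  then show "partial_computable (search ?h)" by (rule partial_computable_search)
  have "search ?h n \<noteq> None \<longleftrightarrow> iterates_to (check_step L) (push 0 0 n 0) 0" for n
    by (auto simp: search_None iterates_to_def simp del: not_None_eq)
  also have "\<dots>n \<longleftrightarrow> n \<in> gn ` sentences L" for n
  proof
    assume "iterates_to (check_step L) (push 0 0 n 0) 0"
    then have "valid_task L 0 0 n"
      using valid_stack_if_iterates_to_0 valid_stack_push by blast
    then show "n \<in> gn ` sentences L" by (auto simp: valid_task_def sentences_def)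
  next
    assume "n \<in> gn ` sentences L"
    then show "iterates_to (check_step L) (push 0 0 n 0) 0"
      by (auto simp: sentences_def intro: check_formula)
  qed
  finally show "search ?h n \<noteq> None \<longleftrightarrow> n \<in> gn ` sentences L" for n .
qed


section \<open>The diagonal construction\<close>

text \<open>Running both enumerations in parallel: \<open>W i\<close> and \<open>W j\<close> need not be disjoint, so the
  first one to contain \<open>n\<close> decides.\<close>

lemma first_entry:
  obtains \<delta> where "partial_computable \<delta>"
    "\<And>i j n z. \<delta> (pair (pair i j) n) = Some z \<Longrightarrow>
       z = n \<and> n \<in> W i \<or> z = pair 2 n \<and> n \<in> W j"
    "\<And>i j n. \<delta> (pair (pair i j) n) = None \<Longrightarrow> n \<notin> W i \<union> W j"
proof -
  define h where "h w = (let i = lft (lft (lft w)); j = rgt (lft (lft w)); n = rgt (lft w); t = rgt w in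
    if halt i n t = 0 then if halt j n t = 0 then 1 else 0 else (0::nat))" for w
  \<comment> \<open>\<open>pair 2 n\<close> is the code of the negation of the formula coded by
    \<open>n\<close>. If both sets show \<open>n\<close> at the same stage, \<open>W i\<close>
    wins.\<close>
  define g where "g w = (let i = lft (lft (lft w)); n = rgt (lft w); t = rgt w in
    if halt i n t = 0 then pair 2 n else n)" for w
  define \<delta> where "\<delta> v = Option.bind (search h v) (\<lambda>t. Some (g (pair v t)))" for v
  have "computable h" "computable g"
    unfolding h_def g_def Let_def by (intro computable_intros computable_halt)+
  then have "partial_computable \<delta>"
    unfolding \<delta>_def
    by (intro partial_computable_bind partial_computable_search partial_computable_of_computable)
  moreover have "z = n \<and> n \<in> W i \<or> z = pair 2 n \<and> n \<in> W j"
    if "\<delta> (pair (pair i j) n) = Some z" for i j n z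
  proof -
    from that obtain t where t: "search h (pair (pair i j) n) = Some t"
      and z: "z = g (pair (pair (pair i j) n) t)"
      by (auto simp: \<delta>_def bind_eq_Some_conv)
    from search_Some[OF t] z show ?thesis
      by (auto simp: h_def g_def Let_def mem_W_iff split: if_splits)
  qed
  moreover have "n \<notin> W i \<union> W j" if "\<delta> (pair (pair i j) n) = None" for i j n
  proof -
    from that have "search h (pair (pair i j) n) = None"
      by (auto simp: \<delta>_def bind_eq_None_conv)
    then have "halt i n t = 0 \<and> halt j n t = 0" for t
      by (auto simp: search_None h_def Let_def split: if_splits)
    then show ?thesis by (simp add: mem_W_iff)
  qed
  ultimately show ?thesis by (rule that)
qed

text \<open>A contradiction from \<open>p\<close> over \<open>U\<close> would yield
  \<open>Neg p\<close> by \<open>NegI\<close>.\<close>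

lemma consistent_insert:
  assumes "p \<in> sentences L" "\<not> deriv L U (Neg p)"
  shows "consistent L (insert p U)"
proof -
  have "wf_fm L p" using assms(1) by (simp add: sentences_def)
  from NegI[OF this] show ?thesis using assms(2) unfolding consistent_def by metis
qed

text \<open>Here classical contradiction \<open>Contr\<close> yields \<open>p\<close> itself from
  the inconsistency.\<close>

lemma consistent_insert_Neg:
  assumes "p \<in> sentences L" "\<not> deriv L U p"
  shows "consistent L (insert (Neg p) U)"
proof -
  have "wf_fm L p" using assms(1) by (simp add: sentences_def)
  from Contr[OF this] show ?thesis using assms(2) unfolding consistent_def by metis
qed

theorem theorem3p1:
  fixes L :: signature
    and U :: "fm set"
    and F :: "fm set \<Rightarrow> fm set"
  assumes "effective_signature L"
    and "ce_theory L U"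
    and "F \<in> Pow (sentences L) \<rightarrow> Pow (sentences L)"
    and "effectively_if_essentially_incomplete L F U"
  shows "effectively_inseparable L (F U) U"
proof -
  have U: "U \<subseteq> sentences L" and "ce (gn ` U)"
    using assms(2) by (auto simp: ce_theory_def is_theory_def)
  then obtain u where u: "gn ` U = W u" by (auto simp: ce_def)
  obtain \<Phi> where \<Phi>: "partial_computable \<Phi>"
    and \<Phi>_indep: "\<And>i T. W i = gn ` T \<Longrightarrow> finite_extension L U T \<Longrightarrow> consistent L T \<Longrightarrow>
      \<exists>p. \<Phi> i = Some (gn p) \<and> p \<in> F T \<and> independent L T p"
    using assms(4) unfolding effectively_if_essentially_incomplete_def by blast
  obtain \<sigma> where \<sigma>: "partial_computable \<sigma>" "\<And>n. \<sigma> n \<noteq> None \<longleftrightarrow> n \<in> gn ` sentences L"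
    using sentence_semidecidable[OF assms(1)] by blast
  obtain \<delta> where \<delta>: "partial_computable \<delta>"
    "\<And>i j n z. \<delta> (pair (pair i j) n) = Some z \<Longrightarrow> z = n \<and> n \<in> W i \<or> z = pair 2 n \<and> n \<in> W j"
    "\<And>i j n. \<delta> (pair (pair i j) n) = None \<Longrightarrow> n \<notin> W i \<union> W j"
    using first_entry by blast
  \<comment> \<open>\<open>y\<close> pairs the own index with \<open>pair i j\<close>. The value of
    \<sigma> is discarded; it acts as a gate that opens only for codes of sentences.\<close>
  define D where "D y = Option.bind (\<Phi> (lft y)) (\<lambda>n. Option.bind (\<sigma> n) (\<lambda>_. \<delta> (pair (rgt y) n)))" for y
  have "partial_computable D"
  proof -
    \<comment> \<open>Each bind pairs its value onto the previous argument: \<open>w\<close> is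
      \<open>pair y n\<close>, so \<open>lft (lft (pair w m))\<close> recovers
      \<open>y\<close>.\<close>
    have "partial_computable (\<lambda>w. Option.bind (\<sigma> (rgt w))
        (\<lambda>m. \<delta> (pair (rgt (lft (lft (pair w m)))) (rgt (lft (pair w m))))))"
      by (intro partial_computable_bind partial_computable_comp[OF \<sigma>(1)]
          partial_computable_comp[OF \<delta>(1)] computable_intros)
    from partial_computable_bind[OF this partial_computable_comp[OF \<Phi>]]
    show ?thesis by (simp add: D_def[abs_def] computable_lft computable_id)
  qed
  then obtain \<kappa> where \<kappa>: "computable \<kappa>"
    and W\<kappa>: "\<And>c. W (\<kappa> c) = W u \<union> {z. D (pair (\<kappa> c) c) = Some z}"
    using self_referential_adjoin by blast
  have "\<exists>p. \<Phi> (\<kappa> (pair i j)) = Some (gn p) \<and> p \<in> F U \<and> gn p \<notin> W i \<union> W j"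
    if sep: "weakly_biseparate (W i) (W j) (gn ` provable_set L U) (gn ` refutable_set L U)" for i j
  proof -
    let ?k = "\<kappa> (pair i j)"
    have D: "D (pair ?k (pair i j)) = Option.bind (\<Phi> ?k) (\<lambda>n. Option.bind (\<sigma> n) (\<lambda>_. \<delta> (pair (pair i j) n)))"
      by (simp add: D_def)
    have not_refutable: "\<not> deriv L U (Neg p)" if "p \<in> sentences L" "gn p \<in> W i" for p
      using sep that by (auto simp: weakly_biseparate_def refutable_set_def)
    have not_provable: "\<not> deriv L U p" if "p \<in> sentences L" "gn p \<in> W j" for p
      using sep that by (auto simp: weakly_biseparate_def provable_set_def)
    \<comment> \<open>A sentence both provable and refutable would lie in \<open>W i\<close>, whose
      sentences are not refutable.\<close>
    have "consistent L U"
      using sep not_refutable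
      by (auto simp: weakly_biseparate_def consistent_def provable_set_def)
    have "D (pair ?k (pair i j)) = None"
    proof (rule ccontr)
      assume "D (pair ?k (pair i j)) \<noteq> None"
      then obtain z n where z: "D (pair ?k (pair i j)) = Some z"
        and n: "\<Phi> ?k = Some n" "\<sigma> n \<noteq> None" and \<delta>z: "\<delta> (pair (pair i j) n) = Some z"
        unfolding D by (auto simp: bind_eq_Some_conv)
      obtain p where p: "p \<in> sentences L" "n = gn p" using n(2) \<sigma>(2) by blast
      obtain q where q: "q = p \<or> q = Neg p" "gn q = z" "consistent L (insert q U)"
      proof (cases "z = n \<and> n \<in> W i")
        case True
        then have "consistent L (insert p U)"
          using p not_refutable by (intro consistent_insert) auto
        with True p that show ?thesis by blast
      next
        case False
        then have "z = pair 2 n" "n \<in> W j" using \<delta>(2)[OF \<delta>z] by auto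
        moreover from this have "consistent L (insert (Neg p) U)"
          using p not_provable by (intro consistent_insert_Neg) auto
        ultimately show ?thesis using p that[of "Neg p"] by simp
      qed
      \<comment> \<open>\<open>D\<close> has only the value \<open>z\<close> at this argument, so
        exactly the axiom \<open>q\<close> is adjoined.\<close>
      have "W ?k = gn ` insert q U"
        using W\<kappa>[of "pair i j"] z q(2) u by auto
      moreover have "finite_extension L U (insert q U)"
        using U p(1) q(1)
        by (auto simp: finite_extension_def is_theory_def sentences_def insert_Diff_if)
      ultimately obtain r where "\<Phi> ?k = Some (gn r)" "independent L (insert q U) r"
        using \<Phi>_indep q(3) by blast
      moreover from this have "r = p"
        using n(1) p(2) inj_gn by (auto dest: injD)
      \<comment> \<open>The sentence claimed independent, or its negation, is the new axiom
        \<open>q\<close>.\<close>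
      ultimately show False
        using q(1) deriv.Assm[of q "insert q U" L] by (auto simp: independent_def)
    qed
    then have "W ?k = gn ` U" using W\<kappa>[of "pair i j"] u by simp
    moreover have "finite_extension L U U"
      using U by (simp add: finite_extension_def is_theory_def)
    ultimately obtain p where p: "\<Phi> ?k = Some (gn p)" "p \<in> F U" "independent L U p"
      using \<Phi>_indep \<open>consistent L U\<close> by blast
    \<comment> \<open>Independence includes being a sentence, so the gate opens and the divergence
      of \<open>D\<close> must come from \<delta>.\<close>
    then have "\<sigma> (gn p) \<noteq> None" using \<sigma>(2) by (auto simp: independent_def)
    then have "\<delta> (pair (pair i j) (gn p)) = None"
      using \<open>D _ = None\<close> p(1) by (auto simp: D)
    then show ?thesis using p \<delta>(3) by blast
  qed
  moreover have "partial_computable2 (\<lambda>i j. \<Phi> (\<kappa> (pair i j)))"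
    using partial_computable_comp[OF \<Phi> \<kappa>] by (simp add: partial_computable2_def case_prod_beta)
  ultimately show ?thesis unfolding effectively_inseparable_def by blast
qed

end
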